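(* For every integer $n\ge 1$, the numbers of time-dependent assembly trees satisfying the connected gluing rule for the path graph $P_{n+1}$ and the star graph $S_{n+1}$, each on $n+1$ vertices, satisfy $$a^C_t(P_{n+1})=a^C_t(S_{n+1})=\sum_{k=1}^{n}k!\,S_2(n,k),$$ where $S_2(n,k)$ denotes the Stirling number of the second kind.
   Context: All graphs are finite and simple. Let $G=(V,E)$ be a connected graph with $|V|=N\ge 2$. A time-dependent assembly tree for $G$ is a rooted (unordered) tree each of whose nodes is labeled by a pair $(U,i)$ with $U\subseteq V$ and $i$ a nonnegative integer, such that: (1) the leaves are exactly $N$ in number, labeled $(v,0)$, one for each vertex $v\in V$ ($v$ identified with $\{v\}$); (2) each internal (non-leaf) node has at least two children; (3) the root is labeled $(V,m)$ for some $1\le m\le N-1$; (4) for each internal node $(U,i)$, $U$ is the union of the vertex sets labeling its children (equivalently, the set of leaves below it); (5) if $(U,i)$ and $(U',i')$ are adjacent nodes with $U\subseteq U'$, then $i<i'$; (6) for each $0\le i\le m$ there exists a node labeled $(U,i)$ for some $U\subseteq V$. Two such trees are the same if there is a label-preserving isomorphism of rooted trees between them. Such a tree satisfies the connected gluing rule if for each internal node $(U,i)$ the subgraph of $G$ induced by $U$ is connected. $a_t^C(G)$ is the number of time-dependent assembly trees for $G$ satisfying the connected gluing rule. The star graph $S_{n+1}$ has one center vertex and $n$ other vertices, each adjacent to the center only. The path graph $P_{n+1}$ has vertices $1,\dots,n+1$ and edges $\{i,i+1\}$ for $1\le i\le n$. *)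

theory Defs
  imports
    "HOL-Library.Multiset"
    "HOL-Combinatorics.Stirling"
    "Graph_Theory.Digraph_Component"
begin

text \<open>
  Graphs are the symmetric, loop-free, finite digraphs without parallel arcs of \<^locale>\<open>graph\<close>:
  an undirected edge is a pair of opposite arcs.
\<close>

definition path_graph :: "nat \<Rightarrow> nat pair_pre_digraph" where
  "path_graph k = \<lparr> pverts = {1..k},
     parcs = (\<Union>i \<in> {1..<k}. {(i, i + 1), (i + 1, i)}) \<rparr>"

text \<open>The center of the star is \<open>0\<close>; \<open>k\<close> is the total number of vertices.\<close>

definition star_graph :: "nat \<Rightarrow> nat pair_pre_digraph" where
  "star_graph k = \<lparr> pverts = {0..<k}, parcs = (\<Union>i \<in> {1..<k}. {(0, i), (i, 0)}) \<rparr>"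

text \<open>
  Finite rooted unordered trees with labelled nodes. Since the children of a node form a multiset,
  two values are equal iff there is a label-preserving isomorphism of rooted trees between
  the trees they describe, so counting values counts trees up to isomorphism.
\<close>

datatype 'l rtree = Node (lab: 'l) (children: "'l rtree multiset")

text \<open>
  A node is represented by the subtree rooted at it, and the nodes of a tree form a multiset because
  distinct nodes may have isomorphic subtrees.
\<close>

primrec nodes :: "'l rtree \<Rightarrow> 'l rtree multiset" where
  "nodes (Node l ts) = add_mset (Node l ts) (\<Sum>\<^sub># (image_mset nodes ts))"

definition leaves :: "'l rtree \<Rightarrow> 'l rtree multiset" where
  "leaves t = {# s \<in># nodes t. children s = {#} #}"

definition internal_nodes :: "'l rtree \<Rightarrow> 'l rtree multiset" where
  "internal_nodes t = {# s \<in># nodes t. children s \<noteq> {#} #}"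

definition adjacent_nodes :: "'l rtree \<Rightarrow> 'l rtree \<Rightarrow> 'l rtree \<Rightarrow> bool" where
  "adjacent_nodes t s s' \<longleftrightarrow>
     s \<in># nodes t \<and> s' \<in># nodes t \<and> (s' \<in># children s \<or> s \<in># children s')"

text \<open>The first component of a label is a vertex set, the second one is a time.\<close>

type_synonym 'a assembly_tree = "('a set \<times> nat) rtree"

abbreviation vset :: "'a assembly_tree \<Rightarrow> 'a set" where
  "vset s \<equiv> fst (lab s)"

abbreviation time :: "'a assembly_tree \<Rightarrow> nat" where
  "time s \<equiv> snd (lab s)"

text \<open>
  The root is \<open>t\<close> itself, so its time is the number \<open>m\<close> of time steps.
\<close>

definition time_assembly_tree :: "('a, 'b) pre_digraph \<Rightarrow> 'a assembly_tree \<Rightarrow> bool" where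
  "time_assembly_tree G t \<longleftrightarrow>
     (\<forall>s \<in># nodes t. vset s \<subseteq> verts G) \<and>
     image_mset lab (leaves t) = image_mset (\<lambda>v. ({v}, 0)) (mset_set (verts G)) \<and>
     (\<forall>s \<in># internal_nodes t. 2 \<le> size (children s)) \<and>
     vset t = verts G \<and> 1 \<le> time t \<and> time t \<le> card (verts G) - 1 \<and>
     (\<forall>s \<in># internal_nodes t. vset s = (\<Union>c \<in> set_mset (children s). vset c)) \<and>
     (\<forall>s s'. adjacent_nodes t s s' \<and> vset s \<subseteq> vset s' \<longrightarrow> time s < time s') \<and>
     (\<forall>i \<le> time t. \<exists>s \<in># nodes t. time s = i)"

definition connected_gluing :: "('a, 'b) pre_digraph \<Rightarrow> 'a assembly_tree \<Rightarrow> bool" where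
  "connected_gluing G t \<longleftrightarrow>
     (\<forall>s \<in># internal_nodes t. connected (G \<restriction> vset s))"

text \<open>The number $a_t^C(G)$, for a connected graph \<open>G\<close> with at least two vertices.\<close>

definition num_connected_time_trees :: "('a, 'b) pre_digraph \<Rightarrow> nat" where
  "num_connected_time_trees G = card {t. time_assembly_tree G t \<and> connected_gluing G t}"

lemma graph_path_graph: "graph (path_graph k)"
  by unfold_locales (auto simp: path_graph_def symmetric_def sym_def arc_to_ends_def)

lemma graph_star_graph: "graph (star_graph k)"
  by unfold_locales (auto simp: star_graph_def symmetric_def sym_def arc_to_ends_def)

lemma connected_path_graph:
  assumes "k \<ge> 1"
  shows "connected (path_graph k)"
proof -
  interpret graph "path_graph k" by (rule graph_path_graph)
  have r: "1 \<rightarrow>\<^sup>*\<^bsub>path_graph k\<^esub> i" if "1 \<le> i" "i \<le> k" for i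
    using that
  proof (induction i rule: dec_induct)
    case base
    then show ?case using assms by (intro reachable_refl) (simp add: path_graph_def)
  next
    case (step i)
    then have "(i, Suc i) \<in> arcs_ends (path_graph k)" by (auto simp: path_graph_def)
    then show ?case using step by (auto intro: reachable_adj_trans)
  qed
  have "strongly_connected (path_graph k)"
  proof
    show "verts (path_graph k) \<noteq> {}" using assms by (auto simp: path_graph_def)
  next
    fix u v assume "u \<in> verts (path_graph k)" "v \<in> verts (path_graph k)"
    then have "1 \<rightarrow>\<^sup>*\<^bsub>path_graph k\<^esub> u" "1 \<rightarrow>\<^sup>*\<^bsub>path_graph k\<^esub> v"
      using r by (auto simp: path_graph_def)
    then show "u \<rightarrow>\<^sup>*\<^bsub>path_graph k\<^esub> v"
      by (metis symmetric_reachable[OF sym_arcs] reachable_trans)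
  qed
  then show ?thesis
    by (simp add: connected_def strongly_connected_def reachable_mk_symmetric_eq[OF sym_arcs])
qed

lemma connected_star_graph:
  assumes "k \<ge> 1"
  shows "connected (star_graph k)"
proof -
  interpret graph "star_graph k" by (rule graph_star_graph)
  have r: "0 \<rightarrow>\<^sup>*\<^bsub>star_graph k\<^esub> i" if "i < k" for i
  proof (cases "i = 0")
    case True
    have "0 \<in> verts (star_graph k)" using assms by (simp add: star_graph_def)
    then show ?thesis using True by (simp only: reachable_refl)
  next
    case False
    then have "(0, i) \<in> arcs_ends (star_graph k)" using that by (auto simp: star_graph_def)
    then show ?thesis by (rule reachable_adjI)
  qed
  have "strongly_connected (star_graph k)"
  proof
    show "verts (star_graph k) \<noteq> {}" using assms by (auto simp: star_graph_def)
  next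
    fix u v assume "u \<in> verts (star_graph k)" "v \<in> verts (star_graph k)"
    then have "0 \<rightarrow>\<^sup>*\<^bsub>star_graph k\<^esub> u" "0 \<rightarrow>\<^sup>*\<^bsub>star_graph k\<^esub> v"
      using r by (auto simp: star_graph_def)
    then show "u \<rightarrow>\<^sup>*\<^bsub>star_graph k\<^esub> v"
      by (metis symmetric_reachable[OF sym_arcs] reachable_trans)
  qed
  then show ?thesis
    by (simp add: connected_def strongly_connected_def reachable_mk_symmetric_eq[OF sym_arcs])
qed

end

theory Submission
  imports Defs
begin

text \<open>
  Both counts are instances of one fact: for every tree graph with \<open>n\<close> edges, the time-dependent
  assembly trees obeying the connected gluing rule correspond to the surjections from the set of
  edges onto \<open>{1..k}\<close>, where \<open>k\<close> ranges over \<open>1..n\<close>. There are \<open>k! S\<^sub>2(n,k)\<close> of these for each \<open>k\<close>.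
  
  The correspondence sends an assembly tree to the function that gives each edge the time at which
  it is glued, i.e. the time of the smallest node containing both of its ends. An internal node
  labelled \<open>(U, i)\<close> is connected and has at least two children, so some edge joins two of them.
  Every such edge is glued at time \<open>i\<close>, and all other edges inside \<open>U\<close> are glued earlier.
  Therefore the positive times of the tree are exactly the gluing times
  (\<open>times_eq_gluing_times\<close>), and the requirement that every time up to the time of the root occurs
  says that the gluing times fill an interval \<open>{1..k}\<close>. Moreover \<open>i\<close> is the largest gluing time
  inside \<open>U\<close>, and the children of \<open>(U, i)\<close> are the connected components of the edges glued before
  \<open>i\<close>. Both can be read off from the gluing times, so by induction these determine the tree
  (\<open>gluing_tree_eqI\<close>). This half holds for any graph without loops.
  
  Conversely, given a positive function on the edges of a connected set \<open>U\<close>, remove the edges at which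
  its maximum is attained, and recurse into the components. Acyclicity is what makes this work
  (\<open>ex_gluing_tree\<close>): an edge carrying the maximum could otherwise have both ends in one component
  of the remaining edges, and would then be glued too early.
  
  Finally, paths and stars are trees: for each edge there is a set of vertices left only
  through that edge.
\<close>

section \<open>Edges and connected vertex sets\<close>

definition connected_on :: "('a \<times> 'a) set \<Rightarrow> 'a set \<Rightarrow> bool" where
  "connected_on E U \<longleftrightarrow> U \<noteq> {} \<and> (\<forall>u \<in> U. \<forall>v \<in> U. (u, v) \<in> (E \<inter> U \<times> U)\<^sup>*)"

definition edges_in :: "('a \<times> 'a) set \<Rightarrow> 'a set \<Rightarrow> 'a set set" where
  "edges_in E U = {{u, v} | u v. (u, v) \<in> E \<and> u \<in> U \<and> v \<in> U}"

text \<open>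
  Acyclicity in the form in which it is used: every edge is a bridge. In particular there are no loops,
  since the empty walk joins a vertex to itself.
\<close>

definition forest :: "('a \<times> 'a) set \<Rightarrow> bool" where
  "forest E \<longleftrightarrow> sym E \<and> (\<forall>(u, v) \<in> E. (u, v) \<notin> (E - {(u, v), (v, u)})\<^sup>*)"

lemma finite_edges_in: "finite U \<Longrightarrow> finite (edges_in E U)"
  by (rule finite_subset[of _ "Pow U"]) (auto simp: edges_in_def)

lemma edges_inI: "(u, v) \<in> E \<Longrightarrow> u \<in> U \<Longrightarrow> v \<in> U \<Longrightarrow> {u, v} \<in> edges_in E U"
  by (auto simp: edges_in_def)

lemma edges_in_mono: "U \<subseteq> W \<Longrightarrow> edges_in E U \<subseteq> edges_in E W"
  by (auto simp: edges_in_def)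

lemma edges_in_iff_subset: "U \<subseteq> W \<Longrightarrow> e \<in> edges_in E U \<longleftrightarrow> e \<in> edges_in E W \<and> e \<subseteq> U"
  by (auto simp: edges_in_def)

lemma edges_in_subset: "e \<in> edges_in E U \<Longrightarrow> e \<subseteq> U"
  by (auto simp: edges_in_def)

lemma nonempty_edges_in: "e \<in> edges_in E U \<Longrightarrow> e \<noteq> {}"
  by (auto simp: edges_in_def)

lemma forest_sym: "forest E \<Longrightarrow> sym E"
  by (simp add: forest_def)

lemma forest_bridge: "forest E \<Longrightarrow> (u, v) \<in> E \<Longrightarrow> (u, v) \<notin> (E - {(u, v), (v, u)})\<^sup>*"
  by (auto simp: forest_def)

lemma forest_no_loop: "forest E \<Longrightarrow> (u, u) \<notin> E"
  using forest_bridge by fastforce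

lemma edges_in_singleton: "(v, v) \<notin> E \<Longrightarrow> edges_in E {v} = {}"
  by (auto simp: edges_in_def)

lemma rtrancl_leaves_set:
  assumes "(x, y) \<in> R\<^sup>*" "x \<in> A" "y \<notin> A"
  obtains u v where "(u, v) \<in> R" "u \<in> A" "v \<notin> A"
proof -
  have "\<exists>u v. (u, v) \<in> R \<and> u \<in> A \<and> v \<notin> A"
    using assms by (induction rule: rtrancl_induct) blast+
  then show ?thesis using that by blast
qed

lemma pair_not_in_block:
  assumes "disjoint P" "p \<in> P" "u \<in> p" "v \<notin> p" "q \<in> P"
  shows "\<not> {u, v} \<subseteq> q"
proof
  assume "{u, v} \<subseteq> q"
  then have "p = q" using disjointD[OF assms(1,2,5)] assms(3) by auto
  then show False using \<open>{u, v} \<subseteq> q\<close> assms(4) by simp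
qed

section \<open>Assembly trees with unconstrained set of times\<close>

text \<open>
  The assembly trees satisfying the connected gluing rule, except that the set of times may have
  gaps. In contrast to the set of times being an interval, all conditions kept here are
  inherited by subtrees, so that induction applies. Disjoint blocks have distinct vertex sets, so the
  multiset of children is presented as a family indexed by a partition.
\<close>

inductive gluing_tree :: "('a \<times> 'a) set \<Rightarrow> 'a assembly_tree \<Rightarrow> bool" for E where
  leaf: "gluing_tree E (Node ({v}, 0) {#})"
| glue: "finite P \<Longrightarrow> 2 \<le> card P \<Longrightarrow> disjoint P \<Longrightarrow> connected_on E (\<Union>P) \<Longrightarrow>
    \<forall>p \<in> P. gluing_tree E (c p) \<and> vset (c p) = p \<and> time (c p) < i \<Longrightarrow>
    gluing_tree E (Node (\<Union>P, i) (image_mset c (mset_set P)))"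

lemma root_in_nodes [simp]: "t \<in># nodes t"
  by (cases t) simp

lemma gluing_tree_vset:
  "gluing_tree E t \<Longrightarrow> finite (vset t) \<and> vset t \<noteq> {}"
proof (induction rule: gluing_tree.induct)
  case (glue P c i)
  then have "P \<noteq> {}" by auto
  with glue show ?case by (auto 0 3)
qed simp

lemma nodes_glue:
  "finite P \<Longrightarrow> set_mset (nodes (Node l (image_mset c (mset_set P)))) =
     insert (Node l (image_mset c (mset_set P))) (\<Union>p \<in> P. set_mset (nodes (c p)))"
  by auto

lemma gluing_tree_nodes:
  "gluing_tree E t \<Longrightarrow> s \<in># nodes t \<Longrightarrow>
     gluing_tree E s \<and> vset s \<subseteq> vset t \<and> time s \<le> time t"
proof (induction arbitrary: s rule: gluing_tree.induct)
  case (leaf v)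
  then show ?case by (auto intro: gluing_tree.leaf)
next
  case (glue P c i)
  let ?t = "Node (\<Union>P, i) (image_mset c (mset_set P))"
  from glue.prems nodes_glue[OF glue.hyps(1), of "(\<Union>P, i)" c]
  consider "s = ?t" | p where "p \<in> P" "s \<in># nodes (c p)" by auto
  then show ?case
  proof cases
    case 1
    have "gluing_tree E ?t" using glue by (intro gluing_tree.glue) auto
    with 1 show ?thesis by simp
  next
    case 2
    then have "gluing_tree E s" "vset s \<subseteq> p" "time s \<le> time (c p)" "time (c p) < i"
      using glue.IH by auto
    with 2 show ?thesis by auto
  qed
qed

section \<open>The time at which an edge is glued\<close>

text \<open>
  The nodes containing a given edge form a chain along which times increase, so the minimum is the
  time of the smallest such node.
\<close>

definition gluing_time :: "'a assembly_tree \<Rightarrow> 'a set \<Rightarrow> nat" where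
  "gluing_time t e = Min (time ` {s \<in> set_mset (nodes t). e \<subseteq> vset s})"

context
  fixes E :: "('a \<times> 'a) set" and P :: "'a set set" and c :: "'a set \<Rightarrow> 'a assembly_tree" and i :: nat
  assumes finP: "finite P" and disj: "disjoint P"
    and child: "\<forall>p \<in> P. gluing_tree E (c p) \<and> vset (c p) = p \<and> time (c p) < i"
begin

lemma vset_in_block:
  assumes "p \<in> P" "s \<in># nodes (c p)"
  shows "vset s \<subseteq> p"
  using bspec[OF child assms(1)] gluing_tree_nodes[of E "c p" s] assms(2) by simp

text \<open>
  The blocks are disjoint, so of all proper subtrees only the one over \<open>p\<close> contributes nodes
  containing \<open>e\<close>; the root itself comes later than these.
\<close>

lemma gluing_time_in_block:
  assumes "p \<in> P" "e \<subseteq> p" "e \<noteq> {}"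
  shows "gluing_time (Node (\<Union>P, i) (image_mset c (mset_set P))) e = gluing_time (c p) e"
proof -
  let ?t = "Node (\<Union>P, i) (image_mset c (mset_set P))"
  let ?S = "{s \<in> set_mset (nodes (c p)). e \<subseteq> vset s}"
  have "q = p" if "q \<in> P" "s \<in># nodes (c q)" "e \<subseteq> vset s" for q s
  proof -
    have "e \<subseteq> q" using vset_in_block[OF that(1,2)] that(3) by simp
    then have "p \<inter> q \<noteq> {}" using assms(2,3) by blast
    then show ?thesis using disjointD[OF disj that(1) assms(1)] by blast
  qed
  then have "{s \<in> (\<Union>q \<in> P. set_mset (nodes (c q))). e \<subseteq> vset s} = ?S"
    using assms(1) by blast
  moreover have "e \<subseteq> vset ?t" using assms by auto
  ultimately have "{s \<in> set_mset (nodes ?t). e \<subseteq> vset s} = insert ?t ?S"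
    unfolding nodes_glue[OF finP] by blast
  moreover have "c p \<in> ?S" using child assms by auto
  then have "Min (time ` ?S) \<le> time (c p)" by (intro Min_le) auto
  then have "Min (time ` ?S) < i" using child assms(1) by fastforce
  moreover have "time ` ?S \<noteq> {}" using \<open>c p \<in> ?S\<close> by blast
  ultimately show ?thesis unfolding gluing_time_def by simp
qed

lemma gluing_time_across_blocks:
  assumes "e \<subseteq> \<Union>P" "\<And>p. p \<in> P \<Longrightarrow> \<not> e \<subseteq> p"
  shows "gluing_time (Node (\<Union>P, i) (image_mset c (mset_set P))) e = i"
proof -
  let ?t = "Node (\<Union>P, i) (image_mset c (mset_set P))"
  have "\<not> e \<subseteq> vset s" if "p \<in> P" "s \<in># nodes (c p)" for p s
    using vset_in_block[OF that] assms(2)[OF that(1)] by blast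
  then have "{s \<in> (\<Union>p \<in> P. set_mset (nodes (c p))). e \<subseteq> vset s} = {}" by blast
  moreover have "e \<subseteq> vset ?t" using assms(1) by simp
  ultimately have "{s \<in> set_mset (nodes ?t). e \<subseteq> vset s} = {?t}"
    unfolding nodes_glue[OF finP] by blast
  then show ?thesis unfolding gluing_time_def by simp
qed

text \<open>
  The vertex set of the node is connected, and a walk from one block to another has to leave its
  first block.
\<close>

lemma edge_across_blocks:
  assumes "2 \<le> card P" "connected_on E (\<Union>P)"
  obtains e where "e \<in> edges_in E (\<Union>P)" "\<And>p. p \<in> P \<Longrightarrow> \<not> e \<subseteq> p"
proof -
  obtain p where p: "p \<in> P" using assms(1) by fastforce
  have "\<not> P \<subseteq> {p}"
    using assms(1) card_mono[of "{p}" P] by auto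
  then obtain q where q: "q \<in> P" "q \<noteq> p" by blast
  obtain x y where xy: "x \<in> p" "y \<in> q"
    using child p q gluing_tree_vset by (metis ex_in_conv)
  then have "y \<notin> p" using p q disj by (auto simp: disjoint_def)
  moreover have "(x, y) \<in> (E \<inter> \<Union>P \<times> \<Union>P)\<^sup>*"
    using assms(2) xy p q by (auto simp: connected_on_def)
  ultimately obtain u v where uv: "(u, v) \<in> E" "u \<in> \<Union>P" "v \<in> \<Union>P" "u \<in> p" "v \<notin> p"
    using rtrancl_leaves_set[of x y _ p] xy by (metis IntE SigmaE2)
  show ?thesis
  proof (rule that)
    show "{u, v} \<in> edges_in E (\<Union>P)" using uv by (auto intro: edges_inI)
    show "\<not> {u, v} \<subseteq> r" if "r \<in> P" for r
      using pair_not_in_block[OF disj p] uv(4,5) that .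
  qed
qed

end

lemma gluing_time_edges:
  assumes "gluing_tree E t" "\<And>v. (v, v) \<notin> E" "e \<in> edges_in E (vset t)"
  shows "0 < gluing_time t e" "gluing_time t e \<le> time t"
proof -
  have "0 < gluing_time t e \<and> gluing_time t e \<le> time t"
    using assms(1,3)
  proof (induction rule: gluing_tree.induct)
    case (leaf v)
    then show ?case using assms(2) by (auto simp: edges_in_def)
  next
    case (glue P c i)
    have cs: "\<forall>p \<in> P. gluing_tree E (c p) \<and> vset (c p) = p \<and> time (c p) < i"
      using glue.IH by (intro ballI) (drule (1) bspec, elim conjE, intro conjI)
    note c = bspec[OF cs]
    have e: "e \<in> edges_in E (\<Union>P)" using glue.prems by simp
    show ?case
    proof (cases "\<exists>p \<in> P. e \<subseteq> p")
      case True
      then obtain p where p: "p \<in> P" "e \<subseteq> p" by blast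
      have "e \<in> edges_in E p" using e p by (subst edges_in_iff_subset[of _ "\<Union>P"]) auto
      then show ?thesis
        using gluing_time_in_block[OF glue.hyps(1,3) cs p nonempty_edges_in[OF e]] glue.IH p
        by fastforce
    next
      case False
      have "gluing_time (Node (\<Union>P, i) (image_mset c (mset_set P))) e = i"
        using e False by (intro gluing_time_across_blocks[OF glue.hyps(1,3) cs])
          (auto simp: edges_in_def)
      moreover have "0 < i" using glue.hyps(2) c by (metis card.empty equals0I
            gr_zeroI less_nat_zero_code not_numeral_le_zero)
      ultimately show ?thesis by simp
    qed
  qed
  then show "0 < gluing_time t e" "gluing_time t e \<le> time t" by auto
qed

text \<open>
  Time \<open>0\<close> is the time of the leaves. The time of an internal node is the gluing time of an edge across its
  blocks, and conversely gluing times are times of nodes by definition.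
\<close>

lemma times_eq_gluing_times:
  assumes "gluing_tree E t" "\<And>v. (v, v) \<notin> E"
  shows "time ` set_mset (nodes t) = insert 0 (gluing_time t ` edges_in E (vset t))"
  using assms(1)
proof (induction rule: gluing_tree.induct)
  case (leaf v)
  then show ?case using assms(2) by (auto simp: edges_in_def)
next
  case (glue P c i)
  let ?t = "Node (\<Union>P, i) (image_mset c (mset_set P))"
  have cs: "\<forall>p \<in> P. gluing_tree E (c p) \<and> vset (c p) = p \<and> time (c p) < i"
    using glue.IH by (intro ballI) (drule (1) bspec, elim conjE, intro conjI)
  note c = bspec[OF cs]
  note in_block = gluing_time_in_block[OF glue.hyps(1,3) cs]
  note across = gluing_time_across_blocks[OF glue.hyps(1,3) cs]
  have block: "gluing_time ?t ` edges_in E p = gluing_time (c p) ` edges_in E p" if "p \<in> P" for p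
    by (intro image_cong[OF refl] in_block[OF that]) (auto simp: edges_in_def)
  obtain e where e: "e \<in> edges_in E (\<Union>P)" "\<And>p. p \<in> P \<Longrightarrow> \<not> e \<subseteq> p"
    using edge_across_blocks[OF glue.hyps(1,3) cs glue.hyps(2,4)] by blast
  have i: "gluing_time ?t e = i" using e by (intro across) (auto simp: edges_in_def)
  have P: "P \<noteq> {}" using glue.hyps(2) by auto
  have "gluing_time ?t ` edges_in E (\<Union>P) = insert i (\<Union>p \<in> P. gluing_time (c p) ` edges_in E p)"
    (is "?L = ?R")
  proof
    show "?L \<subseteq> ?R"
    proof
      fix j assume "j \<in> ?L"
      then obtain d where d: "d \<in> edges_in E (\<Union>P)" "j = gluing_time ?t d" by blast
      show "j \<in> ?R"
      proof (cases "\<exists>p \<in> P. d \<subseteq> p")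
        case True
        then obtain p where p: "p \<in> P" "d \<subseteq> p" by blast
        then have "d \<in> edges_in E p" using d by (subst edges_in_iff_subset[of _ "\<Union>P"]) auto
        then have "j \<in> gluing_time ?t ` edges_in E p" unfolding d(2) by (rule imageI)
        then show ?thesis unfolding block[OF p(1)] using p(1) by blast
      next
        case False
        then have "j = i" unfolding d(2) using d(1) by (intro across) (auto simp: edges_in_def)
        then show ?thesis by simp
      qed
    qed
    have "gluing_time (c p) ` edges_in E p \<subseteq> ?L" if "p \<in> P" for p
      unfolding block[OF that, symmetric] using that by (intro image_mono edges_in_mono) auto
    moreover have "i \<in> ?L" using imageI[OF e(1), of "gluing_time ?t"] i by simp
    ultimately show "?R \<subseteq> ?L" by (intro insert_subsetI UN_least)
  qed
  moreover have "time ` set_mset (nodes (c p)) = insert 0 (gluing_time (c p) ` edges_in E p)"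
    if "p \<in> P" for p using glue.IH that by auto
  then have "time ` set_mset (nodes ?t) =
      insert i (\<Union>p \<in> P. insert 0 (gluing_time (c p) ` edges_in E p))"
    unfolding nodes_glue[OF glue.hyps(1)] image_insert image_UN by simp
  moreover obtain q where "q \<in> P" using P by blast
  ultimately show ?case by (simp only: rtree.sel fst_conv UN_insert_distrib insert_commute)
qed

section \<open>The gluing times determine the tree\<close>

text \<open>
  The connected components of \<open>U\<close> with respect to the edges to which \<open>f\<close> assigns a value below \<open>i\<close>.
\<close>

definition blocks_before :: "('a \<times> 'a) set \<Rightarrow> ('a set \<Rightarrow> nat) \<Rightarrow> nat \<Rightarrow> 'a set \<Rightarrow> 'a set set" where
  "blocks_before E f i U = (\<lambda>x. {(u, v) \<in> E. u \<in> U \<and> v \<in> U \<and> f {u, v} < i}\<^sup>* `` {x}) ` U"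

lemma blocks_before_cong:
  assumes "\<And>e. e \<in> edges_in E U \<Longrightarrow> f e = g e"
  shows "blocks_before E f i U = blocks_before E g i U"
proof -
  have "{(u, v) \<in> E. u \<in> U \<and> v \<in> U \<and> f {u, v} < i} = {(u, v) \<in> E. u \<in> U \<and> v \<in> U \<and> g {u, v} < i}"
    using assms edges_inI by fastforce
  then show ?thesis by (simp add: blocks_before_def)
qed

lemma gluing_tree_connected:
  "gluing_tree E t \<Longrightarrow> connected_on E (vset t)"
  by (cases rule: gluing_tree.cases) (auto simp: connected_on_def)

text \<open>
  Each block is connected, and its inner edges are glued before time \<open>i\<close>; edges leaving a block
  are glued at time \<open>i\<close>. So the edges glued before \<open>i\<close> connect each block and nothing more.
\<close>

lemma children_are_blocks:
  assumes "finite P" "disjoint P" and loops: "\<And>v. (v, v) \<notin> E"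
    and cs: "\<forall>p \<in> P. gluing_tree E (c p) \<and> vset (c p) = p \<and> time (c p) < i"
  shows "P = blocks_before E (gluing_time (Node (\<Union>P, i) (image_mset c (mset_set P)))) i (\<Union>P)"
proof -
  note c = bspec[OF cs]
  let ?t = "Node (\<Union>P, i) (image_mset c (mset_set P))"
  define F where "F = {(u, v) \<in> E. u \<in> \<Union>P \<and> v \<in> \<Union>P \<and> gluing_time ?t {u, v} < i}"
  note in_block = gluing_time_in_block[OF assms(1,2) cs]
  note across = gluing_time_across_blocks[OF assms(1,2) cs]
  have block: "F\<^sup>* `` {x} = p" if p: "p \<in> P" and x: "x \<in> p" for p x
  proof (intro equalityI subsetI)
    fix y assume y: "y \<in> p"
    have cp: "gluing_tree E (c p)" "vset (c p) = p" "time (c p) < i" using c[OF p] by simp_all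
    have "connected_on E p" using gluing_tree_connected[OF cp(1)] cp(2) by simp
    then have "(x, y) \<in> (E \<inter> p \<times> p)\<^sup>*" using x y by (simp add: connected_on_def)
    moreover have "E \<inter> p \<times> p \<subseteq> F"
    proof
      fix z assume "z \<in> E \<inter> p \<times> p"
      then obtain u v where uv: "z = (u, v)" "(u, v) \<in> E" "u \<in> p" "v \<in> p" by blast
      have "gluing_time ?t {u, v} = gluing_time (c p) {u, v}"
        using p uv by (intro in_block) simp_all
      also have "\<dots> \<le> time (c p)"
        using cp(2) edges_inI[OF uv(2-4)] by (intro gluing_time_edges(2)[OF cp(1) loops]) simp
      finally show "z \<in> F" using uv p cp(3) by (auto simp: F_def)
    qed
    ultimately have "(x, y) \<in> F\<^sup>*" using rtrancl_mono by (meson subsetD)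
    then show "y \<in> F\<^sup>* `` {x}" by simp
  next
    fix y assume "y \<in> F\<^sup>* `` {x}"
    then have xy: "(x, y) \<in> F\<^sup>*" by simp
    show "y \<in> p"
    proof (rule ccontr)
      assume "y \<notin> p"
      then obtain u v where uv: "(u, v) \<in> F" "u \<in> p" "v \<notin> p"
        using rtrancl_leaves_set[OF xy x] by metis
      have "gluing_time ?t {u, v} = i"
        using uv(1) pair_not_in_block[OF assms(2) p uv(2,3)] by (intro across) (simp_all add: F_def)
      then show False using uv(1) by (simp add: F_def)
    qed
  qed
  have "P = (\<lambda>x. F\<^sup>* `` {x}) ` \<Union>P"
  proof (intro equalityI subsetI)
    fix p assume p: "p \<in> P"
    then obtain x where x: "x \<in> p" using c[OF p] gluing_tree_vset[of E "c p"] by auto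
    show "p \<in> (\<lambda>x. F\<^sup>* `` {x}) ` \<Union>P"
      using block[OF p x] p x by (intro image_eqI[of _ _ x]) auto
  next
    fix p assume "p \<in> (\<lambda>x. F\<^sup>* `` {x}) ` \<Union>P"
    then obtain x q where "p = F\<^sup>* `` {x}" "q \<in> P" "x \<in> q" by blast
    then show "p \<in> P" using block by simp
  qed
  then show ?thesis by (simp only: blocks_before_def F_def)
qed

lemma Max_gluing_time:
  assumes "finite P" "2 \<le> card P" "disjoint P" "connected_on E (\<Union>P)"
    and loops: "\<And>v. (v, v) \<notin> E"
    and cs: "\<forall>p \<in> P. gluing_tree E (c p) \<and> vset (c p) = p \<and> time (c p) < i"
  shows "Max (gluing_time (Node (\<Union>P, i) (image_mset c (mset_set P))) ` edges_in E (\<Union>P)) = i"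
proof (rule Max_eqI)
  let ?t = "Node (\<Union>P, i) (image_mset c (mset_set P))"
  have t: "gluing_tree E ?t" using assms by (intro gluing_tree.glue) auto
  have "finite (\<Union>P)" using gluing_tree_vset[OF t] by simp
  then show "finite (gluing_time ?t ` edges_in E (\<Union>P))" by (simp add: finite_edges_in)
  show "j \<le> i" if "j \<in> gluing_time ?t ` edges_in E (\<Union>P)" for j
    using that gluing_time_edges(2)[OF t loops] by auto
  obtain e where e: "e \<in> edges_in E (\<Union>P)" "\<And>p. p \<in> P \<Longrightarrow> \<not> e \<subseteq> p"
    using edge_across_blocks[OF assms(1,3) cs assms(2,4)] by blast
  then have "gluing_time ?t e = i"
    by (intro gluing_time_across_blocks[OF assms(1,3) cs]) (auto simp: edges_in_def)
  then show "i \<in> gluing_time ?t ` edges_in E (\<Union>P)"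
    using imageI[OF e(1), of "gluing_time ?t"] by simp
qed

lemma glued_set_not_singleton:
  assumes "2 \<le> card P" "\<And>p. p \<in> P \<Longrightarrow> p \<noteq> {}"
  shows "\<Union>P \<noteq> {v}"
proof
  assume "\<Union>P = {v}"
  have "p = {v}" if "p \<in> P" for p
    using Union_upper[OF that] \<open>\<Union>P = {v}\<close> assms(2)[OF that] subset_singletonD by metis
  then have "P \<subseteq> {{v}}" by auto
  then have "card P \<le> 1" using card_mono[of "{{v}}" P] by simp
  then show False using assms(1) by simp
qed

text \<open>
  The time of the root and the partition into blocks are recovered from the gluing times by
  \<open>Max_gluing_time\<close> and \<open>children_are_blocks\<close>; the children agree by induction, since within a block
  the gluing times of the tree are those of the child.
\<close>

lemma gluing_tree_eqI:
  assumes "gluing_tree E t" "gluing_tree E t'" "vset t = vset t'"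
    and loops: "\<And>v. (v, v) \<notin> E"
    and "\<And>e. e \<in> edges_in E (vset t) \<Longrightarrow> gluing_time t e = gluing_time t' e"
  shows "t = t'"
  using assms(1,2,3,5)
proof (induction arbitrary: t' rule: gluing_tree.induct)
  case (leaf v)
  from leaf(1) show ?case
  proof (cases rule: gluing_tree.cases)
    case (glue P c i)
    have "p \<noteq> {}" if "p \<in> P" for p
      using bspec[OF glue(6) that] gluing_tree_vset[of E "c p"] by auto
    then show ?thesis using glued_set_not_singleton[OF glue(3), of v] glue(1) leaf(2) by simp
  qed (use leaf(2) in auto)
next
  case (glue P c i)
  let ?t = "Node (\<Union>P, i) (image_mset c (mset_set P))"
  have cs: "\<forall>p \<in> P. gluing_tree E (c p) \<and> vset (c p) = p \<and> time (c p) < i"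
    using glue.IH by (intro ballI) (drule (1) bspec, elim conjE, intro conjI)
  note c = bspec[OF cs]
  from glue.prems(1) show ?case
  proof (cases rule: gluing_tree.cases)
    case (leaf v)
    have "p \<noteq> {}" if "p \<in> P" for p
      using c[OF that] gluing_tree_vset[of E "c p"] by auto
    then show ?thesis
      using glued_set_not_singleton[OF glue.hyps(2), of v] glue.prems(2) leaf by simp
  next
    case t': (glue P' c' i')
    have cs': "\<forall>p \<in> P'. gluing_tree E (c' p) \<and> vset (c' p) = p \<and> time (c' p) < i'"
      using t'(6) by blast
    note c' = bspec[OF cs']
    have U: "\<Union>P' = \<Union>P" using glue.prems(2) t'(1) by simp
    have same: "gluing_time ?t e = gluing_time t' e" if "e \<in> edges_in E (\<Union>P)" for e
      using glue.prems(3) that by simp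
    have "i = Max (gluing_time ?t ` edges_in E (\<Union>P))"
      using Max_gluing_time[OF glue.hyps loops cs] by simp
    also have "\<dots> = Max (gluing_time t' ` edges_in E (\<Union>P))"
      using same by (intro arg_cong[of _ _ Max] image_cong refl)
    also have "\<dots> = i'"
      using Max_gluing_time[OF t'(2-5) loops cs'] t'(1) U by simp
    finally have i: "i' = i" by simp
    have "P = blocks_before E (gluing_time ?t) i (\<Union>P)"
      using children_are_blocks[OF glue.hyps(1,3) loops cs] .
    also have "\<dots> = blocks_before E (gluing_time t') i (\<Union>P)"
      using same by (rule blocks_before_cong)
    also have "\<dots> = P'"
      using children_are_blocks[OF t'(2,4) loops cs'] t'(1) U i by simp
    finally have P: "P' = P" by simp
    have "c p = c' p" if p: "p \<in> P" for p
    proof -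
      have "gluing_time (c p) e = gluing_time (c' p) e" if e: "e \<in> edges_in E (vset (c p))" for e
      proof -
        have ep: "e \<in> edges_in E p" using e c[OF p] by simp
        have e': "e \<in> edges_in E (\<Union>P)" "e \<subseteq> p" "e \<noteq> {}"
          using subsetD[OF edges_in_mono[OF Union_upper[OF p]] ep] edges_in_subset[OF ep]
            nonempty_edges_in[OF ep] by simp_all
        have "gluing_time (c p) e = gluing_time ?t e"
          using gluing_time_in_block[OF glue.hyps(1,3) cs p e'(2,3)] by simp
        also have "\<dots> = gluing_time t' e" using same e'(1) .
        also have "\<dots> = gluing_time (c' p) e"
          unfolding t'(1) using gluing_time_in_block[OF t'(2,4) cs' _ e'(2,3)] p P by simp
        finally show ?thesis .
      qed
      then show ?thesis using bspec[OF glue.IH p] c'[of p] P p by simp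
    qed
    then have "image_mset c (mset_set P) = image_mset c' (mset_set P)"
      using glue.hyps(1) by (intro image_mset_cong) simp
    then show ?thesis using t'(1) i P by simp
  qed
qed

section \<open>Every time function on the edges of a forest arises\<close>

text \<open>
  The root gets the maximum \<open>i\<close> of \<open>f\<close> on the edges in \<open>U\<close>, and its children are built over the components
  of the edges with smaller value. As an edge with value \<open>i\<close> is a bridge, its ends lie in different
  components. This yields at least two components, and shows that the edges with both ends in the same
  component are exactly those with value below \<open>i\<close>.
\<close>

lemma ex_gluing_tree:
  assumes forest: "forest E" and "finite U" "connected_on E U"
    and "\<And>e. e \<in> edges_in E U \<Longrightarrow> 0 < f e"
  shows "\<exists>t. gluing_tree E t \<and> vset t = U \<and> (\<forall>e \<in> edges_in E U. gluing_time t e = f e)"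
  using assms(2-)
proof (induction "card U" arbitrary: U rule: less_induct)
  case less
  have loops: "(v, v) \<notin> E" for v using forest_no_loop[OF forest] .
  show ?case
  proof (cases "\<exists>v. U = {v}")
    case True
    then obtain v where v: "U = {v}" by blast
    then show ?thesis using edges_in_singleton[OF loops] by (intro exI[of _ "Node ({v}, 0) {#}"])
        (auto intro: gluing_tree.leaf)
  next
    case False
    define i where "i = Max (f ` edges_in E U)"
    define F where "F = {(u, v) \<in> E. u \<in> U \<and> v \<in> U \<and> f {u, v} < i}"
    define P where "P = blocks_before E f i U"
    have P_eq: "P = (\<lambda>x. F\<^sup>* `` {x}) ` U" by (simp add: P_def blocks_before_def F_def)
    have fin: "finite (f ` edges_in E U)" using less.prems(1) by (simp add: finite_edges_in)
    obtain x where x: "x \<in> U" using less.prems(2) by (auto simp: connected_on_def)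
    obtain y where y: "y \<in> U" "y \<noteq> x" using False x by blast
    have "(x, y) \<in> (E \<inter> U \<times> U)\<^sup>*" using x y less.prems(2) by (auto simp: connected_on_def)
    then obtain u v where "(u, v) \<in> E \<inter> U \<times> U"
      using rtrancl_leaves_set[of x y _ "{x}"] y(2) by (metis singletonD singletonI)
    then have "edges_in E U \<noteq> {}" using edges_inI[of u v E U] by blast
    then have "i \<in> f ` edges_in E U" unfolding i_def using fin by (intro Max_in) auto
    then obtain a b where ab: "(a, b) \<in> E" "a \<in> U" "b \<in> U" "f {a, b} = i"
      by (auto simp: edges_in_def)
    have le: "f e \<le> i" if "e \<in> edges_in E U" for e using fin that by (simp add: i_def)
    have "0 < i" using less.prems(3) ab edges_inI by metis
    have "sym F" using forest_sym[OF forest] by (auto simp: F_def sym_def insert_commute)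
    then have sym: "sym (F\<^sup>*)" by (rule sym_rtrancl)
    have reach_U: "v \<in> U" if "(u, v) \<in> F\<^sup>*" "u \<in> U" for u v
      using that by (induction rule: rtrancl_induct) (auto simp: F_def)
    have block_eq: "F\<^sup>* `` {z} = p" if "p \<in> P" "z \<in> p" for z p
      using that sym unfolding P_eq by (auto dest: symD intro: rtrancl_trans)
    have UP: "\<Union>P = U" unfolding P_eq using reach_U by auto
    have finP: "finite P" unfolding P_eq using less.prems(1) by simp
    have disj: "disjoint P"
      by (rule disjointI) (use block_eq in blast)
    \<comment> \<open>Acyclicity enters here: an edge with the maximal value is not in \<open>F\<close>, so \<open>F\<close> cannot join
      its ends.\<close>
    have bridge: "(u, v) \<notin> F\<^sup>*" if "(u, v) \<in> E" "f {u, v} = i" for u v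
    proof -
      have "F \<subseteq> E - {(u, v), (v, u)}" using that by (auto simp: F_def insert_commute)
      then show ?thesis using forest_bridge[OF forest that(1)] rtrancl_mono by blast
    qed
    have proper: "p \<noteq> U" if "p \<in> P" for p
      using block_eq[OF that] bridge[OF ab(1,4)] ab(2,3) by blast
    have card2: "2 \<le> card P"
    proof (rule ccontr)
      assume "\<not> 2 \<le> card P"
      then have "card P = 0 \<or> card P = 1" by linarith
      then have "P = {} \<or> (\<exists>p. P = {p})" using finP by (auto simp: card_1_singleton_iff)
      then show False using UP x proper by auto
    qed
    have inner: "f e < i" if e: "p \<in> P" "e \<in> edges_in E p" for p e
    proof -
      obtain u v where uv: "e = {u, v}" "(u, v) \<in> E" "u \<in> p" "v \<in> p"
        using e(2) by (auto simp: edges_in_def)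
      then have "(u, v) \<in> F\<^sup>*" using block_eq[OF e(1)] by blast
      moreover have "f e \<le> i" using e UP edges_in_mono[of p U E] le by blast
      ultimately show ?thesis using bridge[of u v] uv by fastforce
    qed
    have conn: "connected_on E p" if p: "p \<in> P" for p
    proof -
      have "(u, v) \<in> (E \<inter> p \<times> p)\<^sup>*" if "u \<in> p" "(u, v) \<in> F\<^sup>*" for u v
        using that(2)
      proof (induction rule: rtrancl_induct)
        case (step y z)
        have "y \<in> p" "z \<in> p" using block_eq[OF p that(1)] step.hyps by (auto intro: rtrancl_into_rtrancl)
        with step show ?case by (auto simp: F_def intro: rtrancl_into_rtrancl)
      qed simp
      then show ?thesis using p block_eq[OF p] unfolding connected_on_def P_eq by blast
    qed
    have "\<exists>t. gluing_tree E t \<and> vset t = p \<and> (\<forall>e \<in> edges_in E p. gluing_time t e = f e)"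
      if p: "p \<in> P" for p
    proof (rule less.hyps)
      have "p \<subset> U" using p UP proper by blast
      then show "card p < card U" "finite p"
        using less.prems(1) by (auto intro: psubset_card_mono finite_subset)
      show "connected_on E p" using conn[OF p] .
      show "0 < f e" if "e \<in> edges_in E p" for e
        using that less.prems(3) edges_in_mono[of p U E] p UP by blast
    qed
    then obtain c where c: "\<And>p. p \<in> P \<Longrightarrow> gluing_tree E (c p) \<and> vset (c p) = p \<and>
        (\<forall>e \<in> edges_in E p. gluing_time (c p) e = f e)" by metis
    have c_time: "time (c p) < i" if p: "p \<in> P" for p
    proof -
      have "time (c p) \<in> insert 0 (gluing_time (c p) ` edges_in E p)"
        using times_eq_gluing_times[of E "c p"] loops c[OF p] by (metis imageI root_in_nodes)
      then show ?thesis using \<open>0 < i\<close> inner[OF p] c[OF p] by auto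
    qed
    let ?t = "Node (\<Union>P, i) (image_mset c (mset_set P))"
    have c': "\<forall>p \<in> P. gluing_tree E (c p) \<and> vset (c p) = p \<and> time (c p) < i"
      using c c_time by blast
    have "gluing_tree E ?t"
      using finP card2 disj less.prems(2) UP c' by (intro gluing_tree.glue) auto
    moreover have "gluing_time ?t e = f e" if e: "e \<in> edges_in E U" for e
    proof (cases "\<exists>p \<in> P. e \<subseteq> p")
      case True
      then obtain p where p: "p \<in> P" "e \<subseteq> p" by blast
      then have "e \<in> edges_in E p" using e UP by (subst edges_in_iff_subset[of _ U]) auto
      then show ?thesis
        using gluing_time_in_block[OF finP disj c' p nonempty_edges_in[OF e]] c[OF p(1)] by simp
    next
      case False
      have "gluing_time ?t e = i"
        using False e UP by (intro gluing_time_across_blocks[OF finP disj c'])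
          (auto simp: edges_in_def)
      moreover have "f e = i"
      proof (rule ccontr)
        assume "f e \<noteq> i"
        then have "f e < i" using le[OF e] by simp
        obtain u v where uv: "e = {u, v}" "(u, v) \<in> E" "u \<in> U" "v \<in> U"
          using e by (auto simp: edges_in_def)
        then have "(u, v) \<in> F" using \<open>f e < i\<close> by (simp add: F_def)
        then have "e \<subseteq> F\<^sup>* `` {u}" using uv by auto
        then show False using False uv by (auto simp: P_eq)
      qed
      ultimately show ?thesis by simp
    qed
    ultimately show ?thesis using UP by (intro exI[of _ ?t]) simp
  qed
qed


section \<open>Assembly trees satisfying the connected gluing rule\<close>

lemma filter_sum_mset: "filter_mset Q (\<Sum>\<^sub># M) = (\<Sum>\<^sub># (image_mset (filter_mset Q) M))"
  by (induction M) auto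

lemma image_sum_mset: "image_mset f (\<Sum>\<^sub># M) = (\<Sum>\<^sub># (image_mset (image_mset f) M))"
  by (induction M) auto

lemma leaves_Node:
  "leaves (Node l ts) = (if ts = {#} then {#Node l {#}#} else \<Sum>\<^sub># (image_mset leaves ts))"
  by (auto simp: leaves_def[abs_def] filter_sum_mset image_mset.compositionality comp_def)

lemma internal_nodes_child:
  "c \<in># ts \<Longrightarrow> s \<in># internal_nodes c \<Longrightarrow> s \<in># internal_nodes (Node l ts)"
  by (auto simp: internal_nodes_def)

lemma image_lab_leaves_Node:
  "ts \<noteq> {#} \<Longrightarrow> image_mset lab (leaves (Node l ts)) =
     \<Sum>\<^sub># (image_mset (\<lambda>c. image_mset lab (leaves c)) ts)"
  by (simp add: leaves_Node image_sum_mset image_mset.compositionality comp_def)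

lemma mset_set_disjoint_Union:
  assumes "finite P" "disjoint P" "\<And>p. p \<in> P \<Longrightarrow> finite p"
  shows "mset_set (\<Union>P) = (\<Sum>p \<in> P. mset_set p)"
  using assms
proof (induction P rule: finite_induct)
  case (insert p P)
  have "disjoint P" using insert.prems(1) by (auto simp: disjoint_def)
  moreover have "p \<inter> \<Union>P = {}" using insert.prems(1) insert.hyps(2) by (auto simp: disjoint_def)
  moreover have "finite (\<Union>P)" using insert.hyps(1) insert.prems(2) by auto
  ultimately show ?case using insert by (simp add: mset_set_Union)
qed simp

lemma gluing_tree_leaves:
  assumes "gluing_tree E t"
  shows "image_mset lab (leaves t) = image_mset (\<lambda>v. ({v}, 0)) (mset_set (vset t))"
  using assms
proof (induction rule: gluing_tree.induct)
  case (leaf v)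
  then show ?case by (simp add: leaves_Node)
next
  case (glue P c i)
  have P: "P \<noteq> {}" using glue.hyps(2) by auto
  have fin: "finite p" if "p \<in> P" for p
    using bspec[OF glue.IH that] gluing_tree_vset[of E "c p"] by auto
  have "image_mset lab (leaves (Node (\<Union>P, i) (image_mset c (mset_set P)))) =
      (\<Sum>p \<in> P. image_mset lab (leaves (c p)))"
    using P glue.hyps(1)
    by (simp add: image_lab_leaves_Node mset_set_empty_iff image_mset.compositionality comp_def
        sum_unfold_sum_mset)
  also have "\<dots> = (\<Sum>p \<in> P. image_mset (\<lambda>v. ({v}, 0)) (mset_set p))"
    using glue.IH by (intro sum.cong) auto
  also have "\<dots> = image_mset (\<lambda>v. ({v}, 0)) (mset_set (\<Union>P))"
    using mset_set_disjoint_Union[OF glue.hyps(1,3) fin] glue.hyps(1)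
    by (simp add: sum_unfold_sum_mset image_sum_mset image_mset.compositionality comp_def)
  finally show ?case by simp
qed

lemma gluing_tree_child:
  assumes "gluing_tree E t" "s \<in># children t"
  shows "vset s \<subset> vset t \<and> time s < time t"
  using assms(1)
proof (cases rule: gluing_tree.cases)
  case (glue P c i)
  then obtain p where p: "p \<in> P" "s = c p" using assms(2) by auto
  have cp: "vset s = p" "time s < i" using bspec[OF glue(6) p(1)] p(2) by auto
  then have "time s < time t" using glue(1) by simp
  have "\<not> P \<subseteq> {p}" using glue(3) card_mono[of "{p}" P] by auto
  then obtain q where q: "q \<in> P" "q \<noteq> p" by blast
  have "q \<noteq> {}" using bspec[OF glue(6) q(1)] gluing_tree_vset[of E "c q"] by auto
  moreover have "p \<inter> q = {}" using disjointD[OF glue(4) p(1) q(1)] q(2) by simp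
  ultimately have "p \<noteq> \<Union>P" using q(1) by blast
  then have "vset s \<subset> vset t" using p(1) cp(1) glue(1) by auto
  with \<open>time s < time t\<close> show ?thesis by simp
qed (use assms(2) in simp_all)

lemma gluing_tree_internal:
  assumes "gluing_tree E t" "children t \<noteq> {#}"
  shows "2 \<le> size (children t) \<and> vset t = (\<Union>c \<in> set_mset (children t). vset c)"
  using assms(1)
proof (cases rule: gluing_tree.cases)
  case (glue P c i)
  then have "2 \<le> size (children t)" by simp
  have "(\<Union>c \<in> set_mset (children t). vset c) = (\<Union>p \<in> P. vset (c p))"
    using glue(1,2) by simp
  also have "\<dots> = \<Union>P" using glue(6) by (intro arg_cong[of _ _ Union]) auto
  finally have "vset t = (\<Union>c \<in> set_mset (children t). vset c)" using glue(1) by simp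
  with \<open>2 \<le> size (children t)\<close> show ?thesis by simp
qed (use assms(2) in simp_all)

text \<open>
  Relates \<^const>\<open>gluing_tree\<close> to the description of assembly trees by their nodes. That the children
  of a node have disjoint vertex sets is not among the conditions on internal nodes; it follows from the leaves
  being labelled by distinct vertices, as soon as the vertex set of each subtree is known to consist of
  the labels of its leaves. This is why the second part of the conclusion is proved along with the first.
\<close>

lemma gluing_treeI:
  assumes "\<And>l. l \<in># image_mset lab (leaves t) \<Longrightarrow> \<exists>v. l = ({v}, 0)"
    and "\<And>l. count (image_mset lab (leaves t)) l \<le> 1"
    and "\<And>s. s \<in># internal_nodes t \<Longrightarrow> 2 \<le> size (children s) \<and> connected_on E (vset s) \<and>
       vset s = (\<Union>c \<in> set_mset (children s). vset c) \<and> (\<forall>c \<in># children s. time c < time s)"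
  shows "gluing_tree E t \<and> (\<forall>v. v \<in> vset t \<longleftrightarrow> ({v}, 0) \<in># image_mset lab (leaves t))"
  using assms
proof (induction t)
  case (Node l ts)
  show ?case
  proof (cases "ts = {#}")
    case True
    then obtain v where "l = ({v}, 0)" using Node.prems(1) by (auto simp: leaves_Node)
    then show ?thesis using True by (auto simp: leaves_Node intro: gluing_tree.leaf)
  next
    case False
    let ?L = "\<lambda>t. image_mset lab (leaves t)"
    have L: "?L (Node l ts) = \<Sum>\<^sub># (image_mset ?L ts)" by (rule image_lab_leaves_Node[OF False])
    have root: "2 \<le> size ts" "connected_on E (fst l)" "fst l = (\<Union>c \<in> set_mset ts. vset c)"
      "\<And>c. c \<in># ts \<Longrightarrow> time c < snd l"
      using Node.prems(3)[of "Node l ts"] False by (auto simp: internal_nodes_def)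
    have sub: "?L c \<subseteq># ?L (Node l ts)" if c: "c \<in># ts" for c
      unfolding L using multi_member_split[OF c] by auto
    have child: "gluing_tree E c \<and> (\<forall>v. v \<in> vset c \<longleftrightarrow> ({v}, 0) \<in># ?L c)" if c: "c \<in># ts" for c
    proof (rule Node.IH[OF c])
      show "\<exists>v. l = ({v}, 0)" if "l \<in># ?L c" for l
        using Node.prems(1) mset_subset_eqD[OF sub[OF c] that] .
      show "count (?L c) l \<le> 1" for l
        using mset_subset_eq_count[OF sub[OF c]] Node.prems(2) order_trans by blast
    qed (use Node.prems(3) internal_nodes_child[OF c] in blast)
    have nonempty: "vset c \<noteq> {}" if "c \<in># ts" for c
      using gluing_tree_vset[OF conjunct1[OF child[OF that]]] by simp
    \<comment> \<open>A vertex below two children would label two leaves; this makes the children pairwise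
      distinct, so that they are indexed by their vertex sets.\<close>
    have disj: "vset c \<inter> vset d = {}" if split: "ts = add_mset c (add_mset d us)" for c d us
    proof (rule equals0I)
      fix v assume "v \<in> vset c \<inter> vset d"
      then have "({v}, 0) \<in># ?L c" "({v}, 0) \<in># ?L d"
        using child[of c] child[of d] split by auto
      then have "1 \<le> count (?L c) ({v}, 0)" "1 \<le> count (?L d) ({v}, 0)"
        by (simp_all only: One_nat_def Suc_le_eq count_greater_zero_iff)
      moreover have "count (?L (Node l ts)) ({v}, 0) \<ge> count (?L c) ({v}, 0) + count (?L d) ({v}, 0)"
        by (subst L, subst split) simp
      ultimately show False using Node.prems(2)[of "({v}, 0)"] by linarith
    qed
    have disj': "vset c \<inter> vset d = {}" if cd: "c \<in># ts" "d \<in># ts" "c \<noteq> d" for c d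
    proof -
      obtain us where us: "ts = add_mset c us" using multi_member_split[OF cd(1)] by blast
      then have "d \<in># us" using cd by simp
      then obtain vs where "us = add_mset d vs" using multi_member_split by metis
      then show ?thesis using disj us by simp
    qed
    have "count ts c \<le> 1" for c
    proof (rule ccontr)
      assume "\<not> count ts c \<le> 1"
      then have "c \<in># ts" "c \<in># ts - {#c#}" by (auto simp flip: count_greater_zero_iff)
      then obtain us where us: "ts = add_mset c (add_mset c us)"
        by (metis insert_DiffM)
      then show False using disj[OF us] nonempty[of c] by simp
    qed
    then have ts: "ts = mset_set (set_mset ts)"
      by (intro multiset_eqI) (metis count_mset_set(1,3) finite_set_mset le_antisym less_one
          not_le count_greater_zero_iff count_eq_zero_iff)
    have inj: "inj_on vset (set_mset ts)"
      by (rule inj_onI) (metis disj' nonempty inf.idem)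
    define P where "P = vset ` set_mset ts"
    define c where "c = the_inv_into (set_mset ts) vset"
    have inv: "c (vset d) = d" if "d \<in># ts" for d
      using the_inv_into_f_f[OF inj that] by (simp add: c_def)
    have inj_c: "inj_on c P" unfolding P_def by (rule inj_onI) (auto simp: inv)
    have "c ` P = set_mset ts" unfolding P_def by (force simp: inv)
    then have "image_mset c (mset_set P) = ts" using image_mset_mset_set[OF inj_c] ts by simp
    moreover have "\<Union>P = fst l" unfolding P_def root(3) by simp
    moreover have "gluing_tree E (Node (\<Union>P, snd l) (image_mset c (mset_set P)))"
    proof (rule gluing_tree.glue)
      show "finite P" by (simp add: P_def)
      show "2 \<le> card P" using root(1) ts inj by (metis P_def card_image size_mset_set)
      show "disjoint P" unfolding P_def
        by (rule disjointI) (use disj' in blast)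
      show "connected_on E (\<Union>P)" using root(2,3) by (simp add: P_def)
      show "\<forall>p \<in> P. gluing_tree E (c p) \<and> vset (c p) = p \<and> time (c p) < snd l"
        using child root(4) by (auto simp: P_def inv)
    qed
    ultimately have "gluing_tree E (Node l ts)" by simp
    moreover have "v \<in> fst l \<longleftrightarrow> ({v}, 0) \<in># ?L (Node l ts)" for v
      unfolding root(3) L using child by (simp add: in_Union_mset_iff)
    ultimately show ?thesis by simp
  qed
qed


lemma rtrancl_on_eq_rtrancl:
  assumes "R \<subseteq> U \<times> U" "u \<in> U"
  shows "(u, v) \<in> rtrancl_on U R \<longleftrightarrow> (u, v) \<in> R\<^sup>*"
proof
  assume "(u, v) \<in> R\<^sup>*"
  then show "(u, v) \<in> rtrancl_on U R"
    by (induction rule: rtrancl_induct) (use assms in \<open>auto intro: rtrancl_on_into_rtrancl_on\<close>)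
qed (rule rtrancl_on_rtranclI)

lemma (in graph) connected_induce_subgraph_iff:
  "connected (G \<restriction> U) \<longleftrightarrow> connected_on (arcs_ends G) U"
proof -
  let ?R = "arcs_ends G \<inter> U \<times> U"
  interpret H: wf_digraph "G \<restriction> U" by (rule wellformed_induce_subgraph)
  have ends: "arcs_ends (G \<restriction> U) = ?R" by (auto simp: arcs_ends_def arc_to_ends_def)
  have "sym ?R" using sym_arcs by (auto simp: symmetric_def sym_def)
  then have sym: "symmetric (G \<restriction> U)" by (simp add: symmetric_def ends)
  have "u \<rightarrow>\<^sup>*\<^bsub>mk_symmetric (G \<restriction> U)\<^esub> v \<longleftrightarrow> (u, v) \<in> ?R\<^sup>*" if "u \<in> U" for u v
    using rtrancl_on_eq_rtrancl[of ?R U u v] that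
    by (subst H.reachable_mk_symmetric_eq[OF sym]) (simp add: reachable_def ends)
  then show ?thesis
    by (auto simp: connected_def strongly_connected_def connected_on_def)
qed

lemma child_in_nodes: "s \<in># nodes t \<Longrightarrow> c \<in># children s \<Longrightarrow> c \<in># nodes t"
proof (induction t)
  case (Node l ts)
  then consider "s = Node l ts" | d where "d \<in># ts" "s \<in># nodes d" by auto
  then show ?case
  proof cases
    case 1
    then have "c \<in># ts" "c \<in># nodes c" using Node.prems(2) by simp_all
    then have "\<exists>d. d \<in># ts \<and> c \<in># nodes d" by blast
    then show ?thesis by auto
  next
    case 2
    then have "c \<in># nodes d" using Node.IH Node.prems(2) by simp
    then show ?thesis using 2(1) by auto
  qed
qed

theorem (in graph) time_assembly_tree_iff:
  "time_assembly_tree G t \<and> connected_gluing G t \<longleftrightarrow>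
     gluing_tree (arcs_ends G) t \<and> vset t = verts G \<and>
     time ` set_mset (nodes t) = {..time t} \<and> 1 \<le> time t \<and> time t \<le> card (verts G) - 1"
  (is "?L \<longleftrightarrow> ?R")
proof
  assume L: ?L
  let ?M = "image_mset lab (leaves t)"
  have leaves: "?M = image_mset (\<lambda>v. ({v}, 0)) (mset_set (verts G))"
    using L by (simp add: time_assembly_tree_def)
  have "gluing_tree (arcs_ends G) t \<and> (\<forall>v. v \<in> vset t \<longleftrightarrow> ({v}, 0) \<in># ?M)"
  proof (rule gluing_treeI)
    show "\<exists>v. l = ({v}, 0)" if "l \<in># ?M" for l using that unfolding leaves by auto
    have "inj_on (\<lambda>v. ({v}, 0::nat)) (verts G)" by (auto simp: inj_on_def)
    then show "count ?M l \<le> 1" for l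
      unfolding leaves by (simp add: image_mset_mset_set count_mset_set')
    fix s assume s: "s \<in># internal_nodes t"
    then have node: "s \<in># nodes t" by (simp add: internal_nodes_def)
    have vs: "vset s = (\<Union>c \<in> set_mset (children s). vset c)"
      using L s by (auto simp: time_assembly_tree_def)
    have "2 \<le> size (children s)" using L s by (simp add: time_assembly_tree_def)
    moreover have "connected_on (arcs_ends G) (vset s)"
      using L s by (simp add: connected_gluing_def connected_induce_subgraph_iff)
    moreover have "time c < time s" if c: "c \<in># children s" for c
    proof -
      have "c \<in># nodes t" using child_in_nodes[OF node c] .
      then have "adjacent_nodes t c s" using node c by (simp add: adjacent_nodes_def)
      moreover have "vset c \<subseteq> vset s" using vs c by auto
      ultimately show ?thesis using L by (simp add: time_assembly_tree_def)
    qed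
    ultimately show "2 \<le> size (children s) \<and> connected_on (arcs_ends G) (vset s) \<and>
       vset s = (\<Union>c \<in> set_mset (children s). vset c) \<and> (\<forall>c \<in># children s. time c < time s)"
      using vs by simp
  qed
  then have tree: "gluing_tree (arcs_ends G) t" by simp
  moreover have "time ` set_mset (nodes t) = {..time t}"
  proof (intro equalityI subsetI)
    fix i assume "i \<in> time ` set_mset (nodes t)"
    then show "i \<in> {..time t}" using gluing_tree_nodes[OF tree] by auto
  next
    fix i assume "i \<in> {..time t}"
    then have "\<exists>s \<in># nodes t. time s = i" using L by (simp add: time_assembly_tree_def)
    then show "i \<in> time ` set_mset (nodes t)" by blast
  qed
  ultimately show ?R using L by (simp add: time_assembly_tree_def)
next
  assume R: ?R
  then have tree: "gluing_tree (arcs_ends G) t" by simp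
  have node: "gluing_tree (arcs_ends G) s" if "s \<in># nodes t" for s
    using gluing_tree_nodes[OF tree that] by simp
  have internal: "gluing_tree (arcs_ends G) s \<and> children s \<noteq> {#}" if "s \<in># internal_nodes t" for s
    using node[of s] that by (simp add: internal_nodes_def)
  have intern: "2 \<le> size (children s) \<and> vset s = (\<Union>c \<in> set_mset (children s). vset c)"
    if "s \<in># internal_nodes t" for s
    using internal[OF that] by (intro gluing_tree_internal[of "arcs_ends G"]) simp_all
  \<comment> \<open>If \<open>s'\<close> is a child of \<open>s\<close>, then \<open>vset s \<subseteq> vset s'\<close> is impossible: \<open>s\<close> has further children, whose
    vertices are not in \<open>s'\<close>.\<close>
  have adj: "time s < time s'" if "adjacent_nodes t s s'" "vset s \<subseteq> vset s'" for s s'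
    using that gluing_tree_child[OF node[of s], of s'] gluing_tree_child[OF node[of s'], of s]
    by (auto simp: adjacent_nodes_def)
  have times: "\<exists>s \<in># nodes t. time s = i" if "i \<le> time t" for i
  proof -
    have "i \<in> time ` set_mset (nodes t)" using R that by simp
    then show ?thesis by blast
  qed
  have sub: "vset s \<subseteq> verts G" if "s \<in># nodes t" for s
    using gluing_tree_nodes[OF tree that] R by simp
  have "time_assembly_tree G t"
    unfolding time_assembly_tree_def
    using R gluing_tree_leaves[OF tree] sub adj times intern by simp
  moreover have "connected_gluing G t"
    unfolding connected_gluing_def connected_induce_subgraph_iff
    using internal gluing_tree_connected by blast
  ultimately show ?L by simp
qed

section \<open>Surjections and Stirling numbers\<close>

text \<open>
  Removing a point \<open>x\<close> from the domain, a surjection onto \<open>B\<close> with value \<open>y\<close> at \<open>x\<close> restricts to a surjection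
  onto \<open>B\<close> or onto \<open>B - {y}\<close>. Multiplying the recursion of \<^const>\<open>Stirling\<close> by a factorial gives the same
  recursion.
\<close>

lemma card_surjections:
  assumes "finite A" "finite B"
  shows "card {f \<in> A \<rightarrow>\<^sub>E B. f ` A = B} = fact (card B) * Stirling (card A) (card B)"
  using assms
proof (induction A arbitrary: B rule: finite_induct)
  case empty
  then show ?case by (cases "card B") auto
next
  case (insert x A)
  let ?S = "\<lambda>A B. {f \<in> A \<rightarrow>\<^sub>E B. f ` A = B}"
  have fin: "finite (?S A C)" if "C \<subseteq> B" for C
    using insert.hyps(1) finite_subset[OF that insert.prems] by (simp add: finite_PiE)
  have "bij_betw (\<lambda>(y, f). f(x := y)) (SIGMA y:B. ?S A B \<union> ?S A (B - {y})) (?S (insert x A) B)"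
    (is "bij_betw _ ?X ?Y")
  proof (rule bij_betw_byWitness[where f' = "\<lambda>g. (g x, g(x := undefined))"])
    show "\<forall>a \<in> ?X. (\<lambda>g. (g x, g(x := undefined))) ((\<lambda>(y, f). f(x := y)) a) = a"
      using insert.hyps(2) by (auto simp: PiE_def extensional_def fun_eq_iff)
    show "\<forall>g \<in> ?Y. (\<lambda>(y, f). f(x := y)) (g x, g(x := undefined)) = g" by auto
    have img: "(f(x := y)) ` A = f ` A" for f :: "'a \<Rightarrow> 'b" and y
      using insert.hyps(2) by (intro image_cong) auto
    show "(\<lambda>(y, f). f(x := y)) ` ?X \<subseteq> ?Y"
    proof
      fix z assume "z \<in> (\<lambda>(y, f). f(x := y)) ` ?X"
      then obtain y f where z: "z = f(x := y)" and y: "y \<in> B" and f: "f \<in> A \<rightarrow>\<^sub>E f ` A"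
        and "f ` A = B \<or> f ` A = B - {y}" by auto
      then have onto: "insert y (f ` A) = B" by auto
      have "z ` insert x A = B" unfolding z image_insert img using onto by simp
      moreover have "z \<in> insert x A \<rightarrow>\<^sub>E insert y (f ` A)"
        unfolding z using f insert.hyps(2) by (intro PiE_fun_upd) auto
      ultimately show "z \<in> ?Y" using onto by simp
    qed
    show "(\<lambda>g. (g x, g(x := undefined))) ` ?Y \<subseteq> ?X"
    proof
      fix z assume "z \<in> (\<lambda>g. (g x, g(x := undefined))) ` ?Y"
      then obtain g where g: "g \<in> insert x A \<rightarrow>\<^sub>E B" "insert (g x) (g ` A) = B"
        and z: "z = (g x, g(x := undefined))" by auto
      define g' where "g' = g(x := undefined)"
      have "g' \<in> A \<rightarrow>\<^sub>E g ` A"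
        using g(1) insert.hyps(2) by (auto simp: g'_def PiE_def extensional_def)
      moreover have "g' ` A = g ` A" unfolding g'_def by (rule img)
      moreover have "g ` A = B \<or> g ` A = B - {g x}" using g(2) by blast
      ultimately have "g' \<in> ?S A B \<union> ?S A (B - {g x})" by auto
      moreover have "z = (g x, g')" "g x \<in> B" using g(2) by (auto simp: z g'_def)
      ultimately show "z \<in> ?X" by blast
    qed
  qed
  then have "card ?Y = card ?X" by (simp add: bij_betw_same_card)
  also have "\<dots> = (\<Sum>y \<in> B. card (?S A B \<union> ?S A (B - {y})))"
    using insert.prems fin by (intro card_SigmaI) auto
  also have "\<dots> = (\<Sum>y \<in> B. card (?S A B) + card (?S A (B - {y})))"
    using fin by (intro sum.cong refl card_Un_disjoint) auto
  also have "\<dots> = (\<Sum>y \<in> B. fact (card B) * Stirling (card A) (card B) +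
      fact (card B - 1) * Stirling (card A) (card B - 1))"
    using insert by (intro sum.cong refl) (simp add: insert.IH)
  also have "\<dots> = fact (card B) * Stirling (card (insert x A)) (card B)"
    using insert.hyps by (cases "card B") (auto simp: algebra_simps)
  finally show ?case .
qed

section \<open>Counting for trees\<close>

text \<open>
  The bijection sends an assembly tree to its gluing times on the edges. The time of the root is the largest
  of them, so it becomes the number \<open>k\<close> of values, and its bounds become \<open>1 \<le> k \<le> n\<close>.
\<close>

theorem num_connected_time_trees_of_tree:
  assumes "graph G" "connected G" and forest: "forest (arcs_ends G)"
    and vertices: "card (verts G) = n + 1" and edges: "card (edges_in (arcs_ends G) (verts G)) = n"
  shows "num_connected_time_trees G = (\<Sum>k = 1..n. fact k * Stirling n k)"
proof -
  interpret graph G by (rule assms(1))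
  define E where "E = arcs_ends G"
  define D where "D = edges_in E (verts G)"
  let ?T = "{t. time_assembly_tree G t \<and> connected_gluing G t}"
  let ?S = "\<lambda>k. {f \<in> D \<rightarrow>\<^sub>E {1..k}. f ` D = {1..k::nat}}"
  have loops: "(v, v) \<notin> E" for v using forest_no_loop[OF forest] by (simp add: E_def)
  have finD: "finite D" by (simp add: D_def finite_edges_in)
  have T_iff: "t \<in> ?T \<longleftrightarrow> gluing_tree E t \<and> vset t = verts G \<and>
      time ` set_mset (nodes t) = {..time t} \<and> 1 \<le> time t \<and> time t \<le> n" for t
    unfolding mem_Collect_eq time_assembly_tree_iff E_def vertices by simp
  have "arcs_ends G \<subseteq> verts G \<times> verts G" by (auto simp: arcs_ends_def arc_to_ends_def)
  then have "G \<restriction> verts G = G" by (auto simp: induce_subgraph_def intro!: pre_digraph.equality)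
  then have conn: "connected_on E (verts G)"
    using assms(2) connected_induce_subgraph_iff[of "verts G"] by (simp add: E_def)
  have "bij_betw (\<lambda>t. restrict (gluing_time t) D) ?T (\<Union>k \<in> {1..n}. ?S k)"
  proof (rule bij_betwI')
    fix t t' assume t: "t \<in> ?T" and t': "t' \<in> ?T"
    show "restrict (gluing_time t) D = restrict (gluing_time t') D \<longleftrightarrow> t = t'"
    proof
      assume eq: "restrict (gluing_time t) D = restrict (gluing_time t') D"
      have "gluing_time t e = gluing_time t' e" if "e \<in> D" for e
        using fun_cong[OF eq, of e] that by simp
      then show "t = t'"
        using t t' loops unfolding T_iff by (intro gluing_tree_eqI[of E]) (auto simp: D_def)
    qed simp
  next
    fix t assume "t \<in> ?T"
    then have t: "gluing_tree E t" "vset t = verts G" "time ` set_mset (nodes t) = {..time t}"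
      "1 \<le> time t" "time t \<le> n" unfolding T_iff by auto
    have "insert 0 (gluing_time t ` D) = {..time t}"
      using times_eq_gluing_times[OF t(1) loops] t(2,3) by (simp add: D_def)
    moreover have "0 \<notin> gluing_time t ` D"
    proof
      assume "0 \<in> gluing_time t ` D"
      then obtain e where "e \<in> edges_in E (vset t)" "gluing_time t e = 0" using t(2) by (auto simp: D_def)
      then show False using gluing_time_edges(1)[OF t(1) loops, of e] by simp
    qed
    ultimately have "gluing_time t ` D = {..time t} - {0}" by blast
    then have "gluing_time t ` D = {1..time t}" by auto
    then have "restrict (gluing_time t) D \<in> ?S (time t)" by auto
    then show "restrict (gluing_time t) D \<in> (\<Union>k \<in> {1..n}. ?S k)"
      using t(4,5) by (intro UN_I[of "time t"]) auto
  next
    fix f assume "f \<in> (\<Union>k \<in> {1..n}. ?S k)"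
    then obtain k where k: "1 \<le> k" "k \<le> n" and f: "f \<in> D \<rightarrow>\<^sub>E {1..k}" "f ` D = {1..k}" by auto
    have "0 < f e" if "e \<in> edges_in E (verts G)" for e
      using imageI[OF that, of f] f(2) by (simp add: D_def)
    then obtain t where t: "gluing_tree E t" "vset t = verts G" "\<And>e. e \<in> D \<Longrightarrow> gluing_time t e = f e"
      using ex_gluing_tree[of E "verts G" f] forest conn unfolding D_def E_def by auto
    have "time ` set_mset (nodes t) = insert 0 (f ` D)"
      using times_eq_gluing_times[OF t(1) loops] t(2,3) by (simp add: D_def)
    then have times: "time ` set_mset (nodes t) = {..k}" using f(2) by auto
    then have "time t \<le> k" using imageI[OF root_in_nodes[of t], of time] by simp
    moreover have "k \<in> time ` set_mset (nodes t)" unfolding times by simp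
    then have "k \<le> time t" using gluing_tree_nodes[OF t(1)] by auto
    ultimately have "time t = k" by simp
    then have "t \<in> ?T" unfolding T_iff using t times k by simp
    moreover have "f = restrict (gluing_time t) D"
      using f(1) t(3) by (intro extensionalityI[of _ D]) (auto simp: PiE_def)
    ultimately show "\<exists>t \<in> ?T. f = restrict (gluing_time t) D" by (rule bexI[rotated])
  qed
  then have "num_connected_time_trees G = card (\<Union>k \<in> {1..n}. ?S k)"
    unfolding num_connected_time_trees_def by (rule bij_betw_same_card)
  also have "\<dots> = (\<Sum>k = 1..n. card (?S k))"
  proof (rule card_UN_disjoint)
    show "\<forall>k \<in> {1..n}. finite (?S k)" using finD by (simp add: finite_PiE)
    show "\<forall>k \<in> {1..n}. \<forall>l \<in> {1..n}. k \<noteq> l \<longrightarrow> ?S k \<inter> ?S l = {}"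
    proof (intro ballI impI equals0I)
      fix k l f assume "k \<noteq> l" "f \<in> ?S k \<inter> ?S l"
      then have "{1..k} = {1..l}" by auto
      then have "card {1..k} = card {1..l}" by (rule arg_cong)
      then show False using \<open>k \<noteq> l\<close> by simp
    qed
  qed simp
  also have "\<dots> = (\<Sum>k = 1..n. fact k * Stirling n k)"
  proof (intro sum.cong refl)
    fix k
    have "card D = n" using edges by (simp add: D_def E_def)
    then show "card (?S k) = fact k * Stirling n k"
      using card_surjections[OF finD, of "{1..k}"] by simp
  qed
  finally show ?thesis .
qed

section \<open>Paths and stars\<close>

text \<open>
  An edge is a bridge if it is the only one leaving some vertex set that contains its first end.
\<close>

lemma forestI:
  assumes "sym E"
    and "\<And>u v. (u, v) \<in> E \<Longrightarrow> \<exists>A. u \<in> A \<and> v \<notin> A \<and> (\<forall>(a, b) \<in> E. a \<in> A \<and> b \<notin> A \<longrightarrow> (a, b) = (u, v))"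
  shows "forest E"
proof -
  have "(u, v) \<notin> (E - {(u, v), (v, u)})\<^sup>*" if uv: "(u, v) \<in> E" for u v
  proof
    assume path: "(u, v) \<in> (E - {(u, v), (v, u)})\<^sup>*"
    obtain A where A: "u \<in> A" "v \<notin> A" "\<And>a b. (a, b) \<in> E \<Longrightarrow> a \<in> A \<Longrightarrow> b \<notin> A \<Longrightarrow> (a, b) = (u, v)"
      using assms(2)[OF uv] by blast
    show False using rtrancl_leaves_set[OF path A(1,2)] A(3) by blast
  qed
  then show ?thesis using assms(1) by (auto simp: forest_def)
qed

lemma arcs_ends_path_graph:
  "arcs_ends (path_graph (n + 1)) = (\<Union>i \<in> {1..n}. {(i, i + 1), (i + 1, i)})"
  by (simp add: path_graph_def atLeastLessThanSuc_atLeastAtMost)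

lemma arcs_ends_star_graph:
  "arcs_ends (star_graph (n + 1)) = (\<Union>i \<in> {1..n}. {(0, i), (i, 0)})"
  by (simp add: star_graph_def atLeastLessThanSuc_atLeastAtMost)

lemma forest_path_graph: "forest (arcs_ends (path_graph (n + 1)))"
proof (rule forestI)
  show "sym (arcs_ends (path_graph (n + 1)))" unfolding arcs_ends_path_graph by (auto simp: sym_def)
  fix u v assume "(u, v) \<in> arcs_ends (path_graph (n + 1))"
  then consider "v = u + 1" | "u = v + 1" unfolding arcs_ends_path_graph by auto
  then show "\<exists>A. u \<in> A \<and> v \<notin> A \<and>
      (\<forall>(a, b) \<in> arcs_ends (path_graph (n + 1)). a \<in> A \<and> b \<notin> A \<longrightarrow> (a, b) = (u, v))"
  proof cases
    case 1
    then show ?thesis unfolding arcs_ends_path_graph by (intro exI[of _ "{..u}"]) auto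
  next
    case 2
    then show ?thesis unfolding arcs_ends_path_graph by (intro exI[of _ "{u..}"]) auto
  qed
qed

lemma forest_star_graph: "forest (arcs_ends (star_graph (n + 1)))"
proof (rule forestI)
  show "sym (arcs_ends (star_graph (n + 1)))" unfolding arcs_ends_star_graph by (auto simp: sym_def)
  fix u v assume "(u, v) \<in> arcs_ends (star_graph (n + 1))"
  then consider "u = 0" "v \<noteq> 0" | "v = 0" "u \<noteq> 0" unfolding arcs_ends_star_graph by auto
  then show "\<exists>A. u \<in> A \<and> v \<notin> A \<and>
      (\<forall>(a, b) \<in> arcs_ends (star_graph (n + 1)). a \<in> A \<and> b \<notin> A \<longrightarrow> (a, b) = (u, v))"
  proof cases
    case 1
    then show ?thesis unfolding arcs_ends_star_graph by (intro exI[of _ "- {v}"]) auto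
  next
    case 2
    then show ?thesis unfolding arcs_ends_star_graph by (intro exI[of _ "{u}"]) auto
  qed
qed

lemma card_edges_path_graph:
  "card (edges_in (arcs_ends (path_graph (n + 1))) (verts (path_graph (n + 1)))) = n"
proof -
  have "edges_in (arcs_ends (path_graph (n + 1))) (verts (path_graph (n + 1))) =
      (\<lambda>i. {i, i + 1}) ` {1..n}"
    unfolding arcs_ends_path_graph edges_in_def by (fastforce simp: path_graph_def)
  moreover have "inj_on (\<lambda>i::nat. {i, i + 1}) {1..n}"
    by (auto simp: inj_on_def doubleton_eq_iff)
  ultimately show ?thesis by (simp add: card_image)
qed

lemma card_edges_star_graph:
  "card (edges_in (arcs_ends (star_graph (n + 1))) (verts (star_graph (n + 1)))) = n"
proof -
  have "edges_in (arcs_ends (star_graph (n + 1))) (verts (star_graph (n + 1))) =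
      (\<lambda>i. {0, i}) ` {1..n}"
    unfolding arcs_ends_star_graph edges_in_def by (fastforce simp: star_graph_def)
  moreover have "inj_on (\<lambda>i::nat. {0, i}) {1..n}"
    by (auto simp: inj_on_def doubleton_eq_iff)
  ultimately show ?thesis by (simp add: card_image)
qed

theorem proposition4p4:
  fixes n :: nat
  assumes "n \<ge> 1"
  shows "num_connected_time_trees (path_graph (n + 1)) = num_connected_time_trees (star_graph (n + 1))
    \<and> num_connected_time_trees (star_graph (n + 1)) = (\<Sum>k = 1..n. fact k * Stirling n k)"
proof -
  have "num_connected_time_trees (path_graph (n + 1)) = (\<Sum>k = 1..n. fact k * Stirling n k)"
    by (intro num_connected_time_trees_of_tree graph_path_graph connected_path_graph
        forest_path_graph card_edges_path_graph) (simp_all add: path_graph_def)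
  moreover have "num_connected_time_trees (star_graph (n + 1)) = (\<Sum>k = 1..n. fact k * Stirling n k)"
    by (intro num_connected_time_trees_of_tree graph_star_graph connected_star_graph
        forest_star_graph card_edges_star_graph) (simp_all add: star_graph_def)
  ultimately show ?thesis by simp
qed

end
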